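(* Let $n,k\in\mathbb{N}$, $0<p<1$, $k\le pn$, and put $f=k/n$. Then $$\frac{\sqrt{n}\,L(n,k,p)}{\sqrt{8k(n-k)}}\,e^{-nD(\frac{k}{n}\|p)}<B_{n,k}(p)<\frac{\sqrt{n}\,U(n,k,p)}{\sqrt{2\pi k(n-k)}}\,e^{-nD(\frac{k}{n}\|p)},$$ $$B_{n,k}^{\downarrow}(p)<B_{n,k}(p)<B_{n,k}^{\uparrow}(p)<\frac{89}{44}B_{n,k}^{\downarrow}(p),$$ and, if $k<pn$, $$B_{n,k}(p)<B_{n,k}^{\uparrow}(p)<\frac{\sqrt{1-f}\,p}{\sqrt{2\pi f}\,(p-f)}\,e^{-nD(f\|p)}.$$
   Context: $\mathbb{N}$ denotes the positive integers and $\mathbb{N}_0$ the nonnegative integers. Throughout $q=1-p$. For integers $0\le k\le n$, $B_{n,k}(p)=\sum_{j=0}^k\binom{n}{j}p^jq^{n-j}$. The relative entropy is $D(f\|p)=f\ln\frac{f}{p}+(1-f)\ln\frac{1-f}{1-p}$. For $n\ge 0$, $0<p<1$, $0\le k\le pn$ define $$L(n,k,p)=\frac{k+1-pn+\sqrt{(pn-k+1)^2+4qk}}{2},$$ $$V(n,k,p,a)=a+\frac{p(n-k+a+1)}{pn+p-k+a},\qquad U(n,k,p)=\min_{a\in\mathbb{N}_0}V(n,k,p,a).$$ For $0<p<1$ and $1\le k\le n-1$ define $$B_{n,k}^{\downarrow}(p)=\frac{\sqrt{n}\,L(n,k,p)}{\sqrt{2\pi k(n-k)}}\,e^{-nD(\frac{k}{n}\|p)}\,e^{\frac{1}{12n}-\frac{1}{12k}-\frac{1}{12(n-k)}},$$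 $$B_{n,k}^{\uparrow}(p)=\frac{\sqrt{n}\,U(n,k,p)}{\sqrt{2\pi k(n-k)}}\,e^{-nD(\frac{k}{n}\|p)}\,e^{\frac{1}{12n+1}-\frac{1}{12k+1}-\frac{1}{12(n-k)+1}}.$$ *)

theory Defs
  imports "HOL-Analysis.Analysis"
begin

definition binom_cdf :: "nat \<Rightarrow> nat \<Rightarrow> real \<Rightarrow> real" where
  "binom_cdf n k p = (\<Sum>j=0..k. real (n choose j) * p ^ j * (1 - p) ^ (n - j))"

definition rel_entropy :: "real \<Rightarrow> real \<Rightarrow> real" where
  "rel_entropy f p = f * ln (f / p) + (1 - f) * ln ((1 - f) / (1 - p))"

definition L_coef :: "nat \<Rightarrow> nat \<Rightarrow> real \<Rightarrow> real" where
  "L_coef n k p =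
     (real k + 1 - p * real n + sqrt ((p * real n - real k + 1)\<^sup>2 + 4 * (1 - p) * real k)) / 2"

definition V_coef :: "nat \<Rightarrow> nat \<Rightarrow> real \<Rightarrow> nat \<Rightarrow> real" where
  "V_coef n k p a =
     real a + p * (real n - real k + real a + 1) / (p * real n + p - real k + real a)"

text \<open>The minimum over all \<open>a \<ge> 0\<close> is written as an infimum; \<open>U_coef_is_min\<close> below
  shows that it is attained on the parameter range of interest.\<close>

definition U_coef :: "nat \<Rightarrow> nat \<Rightarrow> real \<Rightarrow> real" where
  "U_coef n k p = (INF a. V_coef n k p a)"

definition B_down :: "nat \<Rightarrow> nat \<Rightarrow> real \<Rightarrow> real" where
  "B_down n k p =
     sqrt (real n) * L_coef n k p / sqrt (2 * pi * real k * (real n - real k))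
     * exp (- real n * rel_entropy (real k / real n) p)
     * exp (1 / (12 * real n) - 1 / (12 * real k) - 1 / (12 * (real n - real k)))"

definition B_up :: "nat \<Rightarrow> nat \<Rightarrow> real \<Rightarrow> real" where
  "B_up n k p =
     sqrt (real n) * U_coef n k p / sqrt (2 * pi * real k * (real n - real k))
     * exp (- real n * rel_entropy (real k / real n) p)
     * exp (1 / (12 * real n + 1) - 1 / (12 * real k + 1) - 1 / (12 * (real n - real k) + 1))"

lemma V_coef_ge:
  assumes "0 < p" "p < 1" "real k \<le> p * real n"
  shows "real a \<le> V_coef n k p a"
proof -
  have "p * real n \<le> real n"
    using assms by (simp add: mult_left_le_one_le)
  then have "0 \<le> p * (real n - real k + real a + 1) / (p * real n + p - real k + real a)"
    using assms by (intro divide_nonneg_nonneg mult_nonneg_nonneg) auto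
  then show ?thesis
    by (simp add: V_coef_def)
qed

lemma U_coef_is_min:
  assumes "0 < p" "p < 1" "real k \<le> p * real n"
  shows "\<exists>a. U_coef n k p = V_coef n k p a \<and> (\<forall>b. V_coef n k p a \<le> V_coef n k p b)"
proof -
  let ?V = "V_coef n k p"
  define N where "N = nat \<lceil>?V 0\<rceil>"
  have "\<exists>a\<in>{..N}. \<forall>b\<in>{..N}. ?V a \<le> ?V b"
    using ex_min_if_finite[of "?V ` {..N}"] by (fastforce simp: not_less)
  then obtain a where a: "\<And>b. b \<le> N \<Longrightarrow> ?V a \<le> ?V b"
    by auto
  have min: "?V a \<le> ?V b" for b
  proof (cases "b \<le> N")
    case False
    then have "?V 0 \<le> real b"
      unfolding N_def by linarith
    with V_coef_ge[OF assms, of b] a[of 0] show ?thesis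
      by simp
  qed (rule a)
  have "U_coef n k p = ?V a"
    unfolding U_coef_def by (rule cInf_eq_minimum) (auto intro: min)
  with min show ?thesis
    by blast
qed

end

theory Submission
  imports Defs
begin

text \<open>Write \<open>b\<^sub>k\<close> for the last summand of \<open>B\<^sub>k = B\<^bsub>n,k\<^esub>(p)\<close>. Both sides of
  \<open>L b\<^sub>k < B\<^sub>k < V(a) b\<^sub>k\<close> follow by induction on \<open>k\<close> from \<open>B\<^sub>k = b\<^sub>k + B\<^bsub>k-1\<^esub>\<close>: for \<open>L\<close> because it
  is the root of \<open>(L - 1)(L + pn - k) = qk\<close>, and for \<open>V\<close> because \<open>V(n,k,p,a) = 1 + V(n,k-1,p,a-1)\<close>
  and \<open>b\<close> is increasing up to \<open>pn\<close>. Choosing \<open>a\<close> with \<open>L - 1 \<le> a \<le> L\<close> shows \<open>U < 2L\<close>. The summand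
  \<open>b\<^sub>k\<close> is compared with its entropy form through Robbins' bounds in monotone shape:
  the error \<open>\<mu>(n)\<close> in Stirling's formula tends to \<open>0\<close> with \<open>1/(12n) - \<mu>(n)\<close> and \<open>\<mu>(n) - 1/(12n+1)\<close>
  both decreasing, which gives the additive bounds on \<open>\<mu>(k+m) - \<mu>(k) - \<mu>(m)\<close>. The constant
  \<open>89/44\<close> is \<open>2\<close> from \<open>U < 2L\<close> times \<open>89/88\<close> for the gap between the two Robbins factors.\<close>

subsection \<open>Stirling's formula with Robbins' bounds\<close>

text \<open>In the series \<open>x + x^3/3 + x^5/5 + ...\<close>, replacing every coefficient from
  the second on by \<open>1/3\<close> gives a geometric series with this sum. The proof compares
  derivatives, as both sides vanish at 0.\<close>

lemma artanh_upper_bound: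
  fixes x :: real
  assumes "0 < x" "x < 1"
  shows "artanh x < x + x ^ 3 / (3 * (1 - x\<^sup>2))"
proof -
  let ?g = "\<lambda>x::real. x + x ^ 3 / (3 * (1 - x\<^sup>2)) - artanh x"
  have "?g 0 < ?g x"
  proof (rule DERIV_pos_imp_increasing_open[OF assms(1)])
    fix y :: real
    assume y: "0 < y" "y < x"
    with assms have y1: "y\<^sup>2 < 1" "\<bar>y\<bar> < 1" by (auto simp: power_less_one_iff)
    have deriv: "(?g has_real_derivative
        1 + (3 * y\<^sup>2 * (3 * (1 - y\<^sup>2)) - y ^ 3 * (- 6 * y)) / (3 * (1 - y\<^sup>2))\<^sup>2 - 1 / (1 - y\<^sup>2)) (at y)"
      by (rule derivative_eq_intros refl | use y1 in \<open>force simp: power2_eq_square\<close>)+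
    have eq: "1 + (3 * y\<^sup>2 * (3 * (1 - y\<^sup>2)) - y ^ 3 * (- 6 * y)) / (3 * (1 - y\<^sup>2))\<^sup>2 - 1 / (1 - y\<^sup>2)
        = 2 * y ^ 4 / (3 * (1 - y\<^sup>2)\<^sup>2)"
      using y1 by (simp add: divide_simps) (simp add: algebra_simps power2_eq_square power3_eq_cube power4_eq_xxxx)
    have pos: "\<dots> > 0"
      using y y1 by simp
    from deriv pos show "\<exists>d. (?g has_real_derivative d) (at y) \<and> 0 < d"
      unfolding eq by blast
  next
    have sq: "t\<^sup>2 < 1" if "0 \<le> t" "t \<le> x" for t
      using that assms by (intro power_less_one_iff[THEN iffD2]) auto
    show "continuous_on {0..x} ?g"
      using assms by (intro continuous_intros) (auto dest!: sq)
  qed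
  then show ?thesis by simp
qed

text \<open>Here the coefficient \<open>1/(2j+1)\<close> of the series is lowered to
  \<open>1/3^j\<close>, again a geometric series.\<close>

lemma artanh_lower_bound:
  fixes x :: real
  assumes "0 < x" "x < 1"
  shows "x + x ^ 3 / (3 - x\<^sup>2) < artanh x"
proof -
  let ?g = "\<lambda>x::real. artanh x - (x + x ^ 3 / (3 - x\<^sup>2))"
  have "?g 0 < ?g x"
  proof (rule DERIV_pos_imp_increasing_open[OF assms(1)])
    fix y :: real
    assume y: "0 < y" "y < x"
    with assms have y1: "y\<^sup>2 < 1" "\<bar>y\<bar> < 1" by (auto simp: power_less_one_iff)
    have deriv: "(?g has_real_derivative
        1 / (1 - y\<^sup>2) - (1 + (3 * y\<^sup>2 * (3 - y\<^sup>2) - y ^ 3 * (- 2 * y)) / (3 - y\<^sup>2)\<^sup>2)) (at y)"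
      by (rule derivative_eq_intros refl | use y1 in \<open>force simp: power2_eq_square\<close>)+
    have eq: "1 / (1 - y\<^sup>2) - (1 + (3 * y\<^sup>2 * (3 - y\<^sup>2) - y ^ 3 * (- 2 * y)) / (3 - y\<^sup>2)\<^sup>2)
        = 4 * y ^ 4 / ((1 - y\<^sup>2) * (3 - y\<^sup>2)\<^sup>2)"
      using y1 by (simp add: divide_simps) (simp add: algebra_simps power2_eq_square power3_eq_cube power4_eq_xxxx)
    have pos: "\<dots> > 0"
      using y y1 by simp
    from deriv pos show "\<exists>d. (?g has_real_derivative d) (at y) \<and> 0 < d"
      unfolding eq by blast
  next
    have sq: "t\<^sup>2 < 1" if "0 \<le> t" "t \<le> x" for t
      using that assms by (intro power_less_one_iff[THEN iffD2]) auto
    show "continuous_on {0..x} ?g"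
      using assms by (intro continuous_intros) (auto dest!: sq)
  qed
  then show ?thesis by simp
qed

text \<open>For \<open>n \<ge> 1\<close> this is the exponent \<open>mu(n)\<close> in
  \<open>n! = sqrt(2 pi n) (n/e)^n exp(mu(n))\<close>.\<close>

definition stirling_error :: "nat \<Rightarrow> real" where
  "stirling_error n = ln (fact n) - (real n + 1 / 2) * ln (real n) + real n - ln (2 * pi) / 2"

lemma stirling_error_diff:
  assumes "n \<ge> 1"
  shows "stirling_error n - stirling_error (Suc n)
    = (2 * real n + 1) * artanh (1 / (2 * real n + 1)) - 1"
proof -
  have "artanh (1 / (2 * real n + 1)) = ln ((real n + 1) / real n) / 2"
  proof -
    \<comment> \<open>The argument \<open>1/(2n+1)\<close> is the \<open>x\<close> with
      \<open>(1+x)/(1-x) = (n+1)/n\<close>.\<close>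
    have "(1 + 1 / (2 * real n + 1)) / (1 - 1 / (2 * real n + 1)) = (real n + 1) / real n"
      using assms by (simp add: divide_simps)
    then show ?thesis by (simp add: artanh_def)
  qed
  also have "\<dots> = (ln (real n + 1) - ln (real n)) / 2"
    using assms by (simp add: ln_div)
  finally have artanh: "artanh (1 / (2 * real n + 1)) = (ln (real n + 1) - ln (real n)) / 2" .
  have fact: "ln (fact (Suc n)) = ln (real n + 1) + ln (fact n)"
    by (simp only: fact_Suc ln_mult_pos of_nat_Suc of_nat_mult) (simp add: ln_mult add.commute)
  have Suc: "real (Suc n) = real n + 1"
    by simp
  show ?thesis
    unfolding stirling_error_def artanh fact Suc by (simp add: field_simps)
qed

lemma stirling_error_diff_upper:
  assumes "n \<ge> 1"
  shows "stirling_error n - stirling_error (Suc n) < 1 / (12 * real n) - 1 / (12 * real (Suc n))"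
proof -
  define x where "x = 1 / (2 * real n + 1)"
  have x: "0 < x" "x < 1" using assms by (auto simp: x_def)
  have "(1 / x) * artanh x < (1 / x) * (x + x ^ 3 / (3 * (1 - x\<^sup>2)))"
    using artanh_upper_bound[OF x] x by (intro mult_strict_left_mono) auto
  also have "\<dots> = 1 + 1 / (3 * ((1 / x)\<^sup>2 - 1))"
    using x by (auto simp: field_simps power2_eq_square power3_eq_cube)
  \<comment> \<open>The bound telescopes because \<open>(2n+1)^2 - 1 = 4n(n+1)\<close>.\<close>
  also have "\<dots> = 1 + (1 / (12 * real n) - 1 / (12 * real (Suc n)))"
    using assms unfolding x_def by (auto simp: field_simps power2_eq_square)
  finally show ?thesis
    unfolding stirling_error_diff[OF assms] by (simp add: x_def)
qed

lemma stirling_error_diff_lower: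
  assumes "n \<ge> 1"
  shows "1 / (12 * real n + 1) - 1 / (12 * real (Suc n) + 1) < stirling_error n - stirling_error (Suc n)"
proof -
  define x where "x = 1 / (2 * real n + 1)"
  have x: "0 < x" "x < 1" "x\<^sup>2 < 1" using assms by (auto simp: x_def power_less_one_iff)
  have "1 / (12 * real n + 1) - 1 / (12 * real (Suc n) + 1)
      = 12 / ((12 * real n + 1) * (12 * real n + 13))"
    by (simp add: field_simps)
  also have "\<dots> < 1 / (3 * (2 * real n + 1)\<^sup>2 - 1)"
  proof -
    have "1 \<le> (2 * real n + 1)\<^sup>2"
      by (rule one_le_power) simp
    then have pos: "3 * (2 * real n + 1)\<^sup>2 - 1 > 0"
      by linarith
    \<comment> \<open>The right side exceeds the left by \<open>24n - 11\<close>, so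
      \<open>n \<ge> 1\<close> enters here.\<close>
    have "12 * (3 * (2 * real n + 1)\<^sup>2 - 1) < (12 * real n + 1) * (12 * real n + 13)"
      using assms by (simp add: power2_eq_square algebra_simps)
    with pos show ?thesis
      by (simp add: divide_simps)
  qed
  also have "\<dots> = (1 / x) * (x + x ^ 3 / (3 - x\<^sup>2)) - 1"
    using x by (simp add: divide_simps power2_eq_square power3_eq_cube x_def)
  also have "\<dots> < (1 / x) * artanh x - 1"
    using artanh_lower_bound[OF x(1,2)] x by (intro diff_strict_right_mono mult_strict_left_mono) auto
  finally show ?thesis
    unfolding stirling_error_diff[OF assms] by (simp add: x_def)
qed

section \<open>Wallis' product and the limit of the Stirling error\<close>

lemma wallis_product_closed_form:
  "(\<Prod>k=1..n. (4 * real k ^ 2) / (4 * real k ^ 2 - 1))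
    = 2 ^ (4 * n) * fact n ^ 4 / ((fact (2 * n))\<^sup>2 * (2 * real n + 1))"
proof (induction n)
  case (Suc n)
  define A F G N :: real where "A = 2 ^ (4 * n)" "F = fact n" "G = fact (2 * n)" "N = real n"
  note defs = this
  have "4 * (N + 1)\<^sup>2 - 1 = (2 * N + 1) * (2 * N + 3)"
    by (simp add: power2_eq_square algebra_simps)
  with Suc have "(\<Prod>k=1..Suc n. (4 * real k ^ 2) / (4 * real k ^ 2 - 1))
      = A * F ^ 4 / (G\<^sup>2 * (2 * N + 1)) * (4 * (N + 1)\<^sup>2 / ((2 * N + 1) * (2 * N + 3)))"
    by (simp add: defs add.commute)
  also have "\<dots> = 16 * A * ((N + 1) * F) ^ 4
      / (((2 * N + 2) * (2 * N + 1) * G)\<^sup>2 * (2 * (N + 1) + 1))"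
  proof -
    have "A * F ^ 4 * (4 * (N + 1)\<^sup>2) * (((2 * N + 2) * (2 * N + 1) * G)\<^sup>2 * (2 * (N + 1) + 1))
        = 16 * A * ((N + 1) * F) ^ 4 * (G\<^sup>2 * (2 * N + 1) * ((2 * N + 1) * (2 * N + 3)))"
      by algebra
    moreover have "N \<ge> 0" "G \<noteq> 0"
      by (simp_all add: defs)
    ultimately show ?thesis
      unfolding times_divide_times_eq by (subst frac_eq_eq) auto
  qed
  also have "16 * A = 2 ^ (4 * Suc n)"
    by (simp add: defs power_add)
  also have "(N + 1) * F = fact (Suc n)"
    by (simp add: defs add.commute)
  also have "(2 * N + 2) * (2 * N + 1) * G = fact (2 * Suc n)"
    by (simp add: defs algebra_simps)
  also have "N + 1 = real (Suc n)"
    by (simp add: defs)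
  finally show ?case .
qed simp

text \<open>In \<open>2 mu(n) - mu(2n)\<close> all growth cancels and Wallis' product remains. If
  \<open>mu\<close> tends to \<open>c\<close>, so does this combination, hence the limit of the
  product determines \<open>c\<close>.\<close>

lemma stirling_error_double:
  assumes "n \<ge> 1"
  shows "2 * (2 * stirling_error n - stirling_error (2 * n))
    = ln (\<Prod>k=1..n. (4 * real k ^ 2) / (4 * real k ^ 2 - 1)) + ln (2 + 1 / real n) - ln pi"
proof -
  have "ln (2 + 1 / real n) = ln ((2 * real n + 1) / real n)"
    using assms by (simp add: field_simps)
  also have "\<dots> = ln (2 * real n + 1) - ln (real n)"
    using assms by (subst ln_div) auto
  finally have 1: "ln (2 + 1 / real n) = ln (2 * real n + 1) - ln (real n)" .
  have "ln (\<Prod>k=1..n. (4 * real k ^ 2) / (4 * real k ^ 2 - 1))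
    = 4 * n * ln 2 + 4 * ln (fact n) - (2 * ln (fact (2 * n)) + ln (2 * real n + 1))"
    unfolding wallis_product_closed_form
    by (simp add: ln_div ln_mult ln_realpow add_pos_nonneg del: power_mult)
  then show ?thesis
    using assms 1 by (simp add: stirling_error_def ln_mult field_simps)
qed

lemma stirling_error_tendsto_0: "stirling_error \<longlonglongrightarrow> 0"
proof -
  \<comment> \<open>Shifted because the difference bounds start at 1. The limit exists since
    \<open>mu(n)\<close> decreases while \<open>mu(n) - 1/(12n)\<close> increases.\<close>
  let ?e = "\<lambda>n. stirling_error (Suc n)"
  have dec: "?e (Suc n) \<le> ?e n" for n
  proof -
    have "1 / (12 * real (Suc (Suc n)) + 1) < 1 / (12 * real (Suc n) + 1)"
      by (intro divide_strict_left_mono) auto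
    with stirling_error_diff_lower[of "Suc n"] show ?thesis by simp
  qed
  have inc: "?e n - 1 / (12 * real (Suc n)) \<ge> ?e 0 - 1 / 12" for n
  proof (induction n)
    case (Suc n)
    with stirling_error_diff_upper[of "Suc n"] show ?case by simp
  qed simp
  have "decseq ?e" using dec by (rule decseq_SucI)
  moreover have "?e 0 - 1 / 12 \<le> ?e n" for n
    using inc[of n] by (smt (verit) of_nat_0_le_iff divide_nonneg_nonneg)
  ultimately obtain c where "?e \<longlonglongrightarrow> c"
    using decseq_convergent[of ?e "?e 0 - 1 / 12"] by blast
  then have c: "stirling_error \<longlonglongrightarrow> c"
    by (simp add: filterlim_sequentially_Suc)
  moreover have "(\<lambda>n. stirling_error (2 * n)) \<longlonglongrightarrow> c"
    using LIMSEQ_subseq_LIMSEQ[OF c, of "\<lambda>n. 2 * n"] by (simp add: strict_mono_def o_def)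
  ultimately have lim1: "(\<lambda>n. 2 * (2 * stirling_error n - stirling_error (2 * n)))
      \<longlonglongrightarrow> 2 * (2 * c - c)"
    by (intro tendsto_intros)
  have "(\<lambda>n. ln (\<Prod>k=1..n. (4 * real k ^ 2) / (4 * real k ^ 2 - 1)) + ln (2 + 1 / real n) - ln pi)
      \<longlonglongrightarrow> ln (pi / 2) + ln (2 + 0) - ln pi"
    by (intro tendsto_intros wallis lim_1_over_n) auto
  moreover have "\<forall>\<^sub>F n in sequentially.
      ln (\<Prod>k=1..n. (4 * real k ^ 2) / (4 * real k ^ 2 - 1)) + ln (2 + 1 / real n) - ln pi
      = 2 * (2 * stirling_error n - stirling_error (2 * n))"
    using eventually_ge_at_top[of 1] by eventually_elim (simp only: stirling_error_double)
  ultimately have "(\<lambda>n. 2 * (2 * stirling_error n - stirling_error (2 * n)))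
      \<longlonglongrightarrow> ln (pi / 2) + ln (2 + 0) - ln pi"
    by (rule Lim_transform_eventually)
  with lim1 have "2 * (2 * c - c) = ln (pi / 2) + ln (2 + 0) - ln pi"
    by (rule LIMSEQ_unique)
  then have "c = 0" by (simp add: ln_div)
  with c show ?thesis by simp
qed

section \<open>Robbins' bounds for \<open>mu(k+m) - mu(k) - mu(m)\<close>\<close>

lemma strict_decreasing_pos:
  fixes g :: "nat \<Rightarrow> real"
  assumes step: "\<And>n. n \<ge> 1 \<Longrightarrow> g (Suc n) < g n" and lim: "g \<longlonglongrightarrow> 0"
  shows "n \<ge> 1 \<Longrightarrow> 0 < g n" and "1 \<le> m \<Longrightarrow> m < n \<Longrightarrow> g n < g m"
proof -
  show mono: "g n < g m" if "1 \<le> m" "m < n" for m n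
    using that(2,1) by (induction rule: less_Suc_induct) (auto intro: step)
  show "0 < g n" if "n \<ge> 1"
  proof -
    \<comment> \<open>The limit yields only \<open>0 \<le> g (n+1)\<close>; one further strict step
      makes \<open>g n\<close> positive.\<close>
    have "\<forall>\<^sub>F m in sequentially. g m \<le> g (Suc n)"
      using eventually_gt_at_top[of "Suc n"] by eventually_elim (use that mono in force)
    with lim have "0 \<le> g (Suc n)"
      by (intro tendsto_upperbound[of g]) auto
    with step[OF that] show ?thesis by simp
  qed
qed

text \<open>For \<open>g n = 1/(12n) - mu(n)\<close>, the claim is the sum of
  \<open>g(k+m) < g(k)\<close> and \<open>0 < g(m)\<close>. Robbins' bounds taken term by term would
  give only \<open>1/(12(k+m)+1)\<close> as first summand.\<close>

lemma stirling_error_add_lower: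
  assumes "k \<ge> 1" "m \<ge> 1"
  shows "1 / (12 * real (k + m)) - 1 / (12 * real k) - 1 / (12 * real m)
    < stirling_error (k + m) - stirling_error k - stirling_error m"
proof -
  let ?g = "\<lambda>n. 1 / (12 * real n) - stirling_error n"
  have lim: "?g \<longlonglongrightarrow> 0"
    using tendsto_diff[OF tendsto_mult_left[OF lim_1_over_n, of "1/12"] stirling_error_tendsto_0]
    by simp
  have step: "?g (Suc n) < ?g n" if "n \<ge> 1" for n
    using stirling_error_diff_upper[OF that] by simp
  from strict_decreasing_pos(1)[of ?g, OF step lim assms(2)]
    strict_decreasing_pos(2)[of ?g, OF step lim assms(1), of "k + m"] assms
  show ?thesis by simp
qed

text \<open>The same addition for \<open>g n = mu(n) - 1/(12n+1)\<close>; termwise bounds would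
  leave the larger first summand \<open>1/(12(k+m))\<close>.\<close>

lemma stirling_error_add_upper:
  assumes "k \<ge> 1" "m \<ge> 1"
  shows "stirling_error (k + m) - stirling_error k - stirling_error m
    < 1 / (12 * real (k + m) + 1) - 1 / (12 * real k + 1) - 1 / (12 * real m + 1)"
proof -
  let ?g = "\<lambda>n. stirling_error n - 1 / (12 * real n + 1)"
  have "filterlim (\<lambda>n. 1 + 12 * real n) at_top sequentially"
    by (rule filterlim_tendsto_add_at_top[OF tendsto_const
          filterlim_tendsto_pos_mult_at_top[OF tendsto_const _ filterlim_real_sequentially]]) simp
  then have "(\<lambda>n. 1 / (12 * real n + 1)) \<longlonglongrightarrow> 0"
    by (intro real_tendsto_divide_at_top[OF tendsto_const]) (simp add: add.commute)
  from tendsto_diff[OF stirling_error_tendsto_0 this] have lim: "?g \<longlonglongrightarrow> 0"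
    by simp
  have step: "?g (Suc n) < ?g n" if "n \<ge> 1" for n
    using stirling_error_diff_lower[OF that] by simp
  from strict_decreasing_pos(1)[of ?g, OF step lim assms(2)]
    strict_decreasing_pos(2)[of ?g, OF step lim assms(1), of "k + m"] assms
  show ?thesis by simp
qed

subsection \<open>The binomial distribution function and its largest term\<close>

definition binom_term :: "nat \<Rightarrow> nat \<Rightarrow> real \<Rightarrow> real" where
  "binom_term n k p = real (n choose k) * p ^ k * (1 - p) ^ (n - k)"

lemma binom_term_pos:
  assumes "0 < p" "p < 1" "k \<le> n"
  shows "0 < binom_term n k p"
  using assms by (simp add: binom_term_def)

lemma binom_cdf_0: "binom_cdf n 0 p = binom_term n 0 p"
  by (simp add: binom_cdf_def binom_term_def)

lemma binom_cdf_Suc: "binom_cdf n (Suc k) p = binom_cdf n k p + binom_term n (Suc k) p"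
  by (simp add: binom_cdf_def binom_term_def)

text \<open>The ratio of consecutive terms, cross-multiplied; it drives both inductions
  below.\<close>

lemma binom_term_Suc:
  assumes "k < n"
  shows "binom_term n (Suc k) p * ((real k + 1) * (1 - p)) = binom_term n k p * ((real n - real k) * p)"
proof -
  have "Suc k * (n choose Suc k) = (n - k) * (n choose k)"
    by (metis binomial_absorption binomial_absorb_comp)
  then have choose: "(real k + 1) * real (n choose Suc k) = (real n - real k) * real (n choose k)"
    using assms by (metis of_nat_Suc of_nat_diff of_nat_mult less_imp_le add.commute)
  have power: "(1 - p) ^ (n - k) = (1 - p) * (1 - p) ^ (n - Suc k)"
    using assms by (metis Suc_diff_Suc power_Suc)
  have "binom_term n (Suc k) p * ((real k + 1) * (1 - p))
      = (real k + 1) * real (n choose Suc k) * (p * p ^ k * ((1 - p) * (1 - p) ^ (n - Suc k)))"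
    by (simp add: binom_term_def mult_ac)
  also have "\<dots> = binom_term n k p * ((real n - real k) * p)"
    unfolding choose power[symmetric] by (simp add: binom_term_def mult_ac)
  finally show ?thesis .
qed

text \<open>Stirling's formula is inserted for three factorials: the powers of \<open>n\<close>,
  \<open>k\<close>, \<open>m\<close> combine with \<open>p^k q^m\<close> into the entropy factor,
  the powers of \<open>e\<close> cancel as \<open>n = k + m\<close>, and the three errors remain
  exactly.\<close>

lemma binom_term_stirling:
  assumes "k \<ge> 1" "m \<ge> 1" "0 < p" "p < 1"
  defines "n \<equiv> k + m"
  shows "binom_term n k p = sqrt (real n) / sqrt (2 * pi * real k * real m)
    * exp (- real n * rel_entropy (real k / real n) p)
    * exp (stirling_error n - stirling_error k - stirling_error m)"
proof -
  have pos: "0 < real k" "0 < real m" "0 < real n"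
    using assms by auto
  have "real (n choose k) = fact n / (fact k * fact m)"
    unfolding n_def by (subst binomial_fact) auto
  then have lnbin: "ln (real (n choose k)) = ln (fact n) - (ln (fact k) + ln (fact m))"
    by (simp add: ln_div ln_mult)
  have "1 - real k / real n = real m / real n"
    using pos by (simp add: n_def field_simps)
  moreover have "ln (real k / real n / p) = ln (real k) - ln (real n) - ln p"
    "ln (real m / real n / (1 - p)) = ln (real m) - ln (real n) - ln (1 - p)"
    using pos assms(3,4) by (simp_all add: ln_div ln_mult del: of_nat_add)
  moreover have "real n * (real k / real n) = real k" "real n * (real m / real n) = real m"
    using pos by simp_all
  ultimately have entropy: "real n * rel_entropy (real k / real n) p
      = real k * (ln (real k) - ln (real n) - ln p) + real m * (ln (real m) - ln (real n) - ln (1 - p))"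
    unfolding rel_entropy_def by (simp only: distrib_left mult.assoc[symmetric])
  have "binom_term n k p = exp (ln (real (n choose k)) + real k * ln p + real m * ln (1 - p))"
    using assms(3,4) unfolding binom_term_def n_def
    by (simp add: exp_add exp_of_nat_mult)
  also have "\<dots> = exp ((ln (real n) - (ln (2 * pi) + ln (real k) + ln (real m))) / 2
      - real n * rel_entropy (real k / real n) p
      + (stirling_error n - stirling_error k - stirling_error m))"
  proof -
    have n: "real n = real k + real m" by (simp add: n_def)
    show ?thesis
      unfolding entropy lnbin stirling_error_def
      by (simp add: n field_simps)
  qed
  also have "\<dots> = sqrt (real n) / sqrt (2 * pi * real k * real m)
      * exp (- real n * rel_entropy (real k / real n) p)
      * exp (stirling_error n - stirling_error k - stirling_error m)"
  proof -
    have "exp ((ln (real n) - (ln (2 * pi) + ln (real k) + ln (real m))) / 2)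
        = exp (ln (sqrt (real n / (2 * pi * real k * real m))))"
      using pos by (simp add: ln_sqrt ln_div ln_mult)
    also have "\<dots> = sqrt (real n) / sqrt (2 * pi * real k * real m)"
      using pos by (simp add: real_sqrt_divide)
    finally show ?thesis
      by (simp only: exp_add diff_conv_add_uminus[of _ "real n * _"] mult_minus_left)
  qed
  finally show ?thesis .
qed

text \<open>Lowering \<open>y\<close> to 2 and then \<open>x\<close> to 1 only increases the left
  side; \<open>7/6\<close> is its value at \<open>(1, 2)\<close>.\<close>

lemma reciprocal_sum_bound:
  fixes x y :: real
  assumes "x \<ge> 1" "y \<ge> 2"
  shows "1 / x + 1 / y - 1 / (x + y) \<le> 7 / 6"
proof -
  have "1 / y - 1 / (x + y) = x / (y * (x + y))"
    using assms by (simp add: field_simps)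
  also have "\<dots> \<le> x / (2 * (x + 2))"
    using assms by (intro divide_left_mono mult_mono) auto
  also have "\<dots> = 1 / 2 - 1 / (x + 2)"
    using assms by (simp add: field_simps)
  finally have "1 / x + 1 / y - 1 / (x + y) \<le> 1 / 2 + (1 / x - 1 / (x + 2))"
    by simp
  also have "1 / x - 1 / (x + 2) = 2 / (x * (x + 2))"
    using assms by (simp add: field_simps)
  also have "2 / (x * (x + 2)) \<le> 2 / (1 * (1 + 2))"
    using assms by (intro divide_left_mono mult_mono) auto
  finally show ?thesis by simp
qed

text \<open>Equality holds at \<open>k = m = 1\<close>, where the Robbins bound alone is too weak.\<close>

lemma pi_div_4_le_exp_stirling_error:
  assumes "k \<ge> 1" "m \<ge> 1"
  shows "pi / 4 \<le> exp (2 * (stirling_error (k + m) - stirling_error k - stirling_error m))"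
proof (cases "k = 1 \<and> m = 1")
  case True
  have "2 * (stirling_error 2 - stirling_error 1 - stirling_error 1) = ln (2 * pi) - 3 * ln 2"
    by (simp add: stirling_error_def fact_numeral algebra_simps)
  also have "\<dots> = ln (pi / 4)"
  proof -
    have "ln (4::real) = 2 * ln 2"
      using ln_realpow[of 2 2] by simp
    then show ?thesis by (simp add: ln_div ln_mult)
  qed
  finally show ?thesis
    using True by (simp add: numeral_2_eq_2)
next
  case False
  then have "1 / real k + 1 / real m - 1 / (real k + real m) \<le> 7 / 6"
    using reciprocal_sum_bound[of "real k" "real m"] reciprocal_sum_bound[of "real m" "real k"] assms
    by (cases "k = 1") (auto simp: add.commute)
  moreover have "1 / (12 * t) = 1 / 12 * (1 / t)" for t :: real
    by simp
  ultimately have "- (7 / 72) \<le> 1 / (12 * real (k + m)) - 1 / (12 * real k) - 1 / (12 * real m)"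
    by (simp only: of_nat_add)
  then have "- (7 / 72) < stirling_error (k + m) - stirling_error k - stirling_error m"
    using stirling_error_add_lower[OF assms] by (rule le_less_trans)
  then have "- (7 / 36) \<le> 2 * (stirling_error (k + m) - stirling_error k - stirling_error m)"
    by simp
  \<comment> \<open>With \<open>1 + t \<le> exp t\<close>, the exponent bound \<open>-7/36\<close>
    leaves \<open>29/36\<close>, about 0.806, while \<open>pi/4\<close> is about 0.785.\<close>
  moreover have "pi / 4 \<le> 1 + (- (7 / 36))"
    using pi_approx by simp
  ultimately show ?thesis
    using exp_ge_add_one_self[of "2 * (stirling_error (k + m) - stirling_error k - stirling_error m)"]
    by linarith
qed

section \<open>The lower bound with coefficient \<open>L\<close>\<close>

lemma L_coef_ge_1:
  assumes "0 < p" "p < 1"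
  shows "1 \<le> L_coef n k p"
proof -
  define s where "s = sqrt ((p * real n - real k + 1)\<^sup>2 + 4 * (1 - p) * real k)"
  have "p * real n - real k + 1 \<le> s"
    unfolding s_def using assms by (intro real_le_rsqrt) auto
  then show ?thesis
    unfolding L_coef_def s_def[symmetric] by simp
qed

text \<open>Apart from the base case \<open>k = 0\<close>, the bounds use \<open>L\<close> only
  through this equation and \<open>L \<ge> 1\<close>.\<close>

lemma L_coef_quadratic:
  assumes "0 < p" "p < 1"
  shows "(L_coef n k p - 1) * (L_coef n k p + p * real n - real k) = (1 - p) * real k"
proof -
  define s where "s = sqrt ((p * real n - real k + 1)\<^sup>2 + 4 * (1 - p) * real k)"
  have "s\<^sup>2 = (p * real n - real k + 1)\<^sup>2 + 4 * (1 - p) * real k"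
    using assms unfolding s_def by (intro real_sqrt_pow2) auto
  moreover have "2 * L_coef n k p = real k + 1 - p * real n + s"
    by (simp add: L_coef_def s_def)
  ultimately show ?thesis by algebra
qed

text \<open>The algebra of the induction step, with \<open>x = L(k)\<close>,
  \<open>y = L(k+1)\<close>, \<open>d = pn - k\<close>, \<open>K = q(k+1)\<close>,
  \<open>c = p(n-k)\<close>. Since \<open>c/K\<close> is the ratio of the terms and
  \<open>K = (y-1)(y+d-1)\<close>, the claim amounts to \<open>(y-1) b(k+1) < x b(k)\<close>. Its
  negation forces \<open>x \<le> c e / D\<close>, too small for the equation of
  \<open>x\<close>.\<close>

lemma L_coef_quadratics_step:
  fixes x y d q K c :: real
  assumes "x > 0" "d \<ge> 1" "0 < q" "q < 1" "K > 0" "y \<ge> 1"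
    and c: "c = d + K - q" and x: "x\<^sup>2 + (d - 1) * x = c" and y: "(y - 1) * (y + d - 1) = K"
  shows "c < x * (y + d - 1)"
proof (rule ccontr)
  define e where "e = d - q"
  define D where "D = d * e + K"
  have e: "e > 0" and D: "D > 0" and cpos: "c > 0"
    using assms by (auto simp: e_def D_def intro!: add_pos_pos)
  assume "\<not> c < x * (y + d - 1)"
  then have *: "x * (y + d - 1) \<le> c" by simp
  then have **: "x * (y - 1) \<le> c - d * x" by (simp add: algebra_simps)
  moreover have "0 \<le> x * (y - 1)" using assms(1,6) by simp
  ultimately have "0 \<le> c - d * x" by linarith
  \<comment> \<open>Multiplying the two forms of the negated claim eliminates \<open>y\<close>
    through its equation; replacing \<open>x^2\<close> then leaves a linear bound on
    \<open>x\<close>.\<close>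
  with * ** have "(x * (y - 1)) * (x * (y + d - 1)) \<le> (c - d * x) * c"
    using assms(1,2,6) by (intro mult_mono) auto
  then have "K * x\<^sup>2 \<le> (c - d * x) * c"
    unfolding y[symmetric] by (simp add: power2_eq_square mult_ac)
  moreover have "x\<^sup>2 = c - (d - 1) * x" using x by simp
  ultimately have le: "x * D \<le> c * e"
    unfolding D_def e_def c by (simp add: algebra_simps)
  \<comment> \<open>As \<open>d \<ge> 1\<close>, the expression \<open>x^2 + (d-1) x\<close> grows
    with \<open>x > 0\<close>; at \<open>c e / D\<close> it is still below \<open>c\<close>, because
    \<open>D - e^2 = q e + K > 0\<close>.\<close>
  have "c * (D * D) = (x * D)\<^sup>2 + (d - 1) * (x * D) * D"
    unfolding x[symmetric] by (simp add: power2_eq_square algebra_simps)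
  also have "\<dots> \<le> (c * e)\<^sup>2 + (d - 1) * (c * e) * D"
    using le assms D e cpos
    by (intro add_mono mult_right_mono mult_left_mono power_mono) auto
  also have "\<dots> = c * (D * D) - c * c * (D - e\<^sup>2)"
    unfolding D_def e_def c by algebra
  also have "\<dots> < c * (D * D)"
  proof -
    have "D - e\<^sup>2 = q * e + K"
      unfolding D_def e_def by (simp add: power2_eq_square algebra_simps)
    moreover have "0 < q * e + K"
      using e assms(3,5) by (intro add_pos_pos mult_pos_pos)
    ultimately show ?thesis
      using cpos by simp
  qed
  finally show False by simp
qed

lemma L_coef_less_binom_cdf_step:
  assumes "0 < p" "p < 1" "real (Suc k) \<le> p * real n"
    and IH: "L_coef n k p * binom_term n k p \<le> binom_cdf n k p"
  shows "L_coef n (Suc k) p * binom_term n (Suc k) p < binom_cdf n (Suc k) p"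
proof -
  let ?x = "L_coef n k p" and ?y = "L_coef n (Suc k) p" and ?K = "(1 - p) * (real k + 1)"
  \<comment> \<open>The second factor in the equation of \<open>L(k+1)\<close>; being positive, it
    is cancelled at the end.\<close>
  let ?z = "?y + (p * real n - real k) - 1"
  have "p * real n \<le> real n"
    using assms by (simp add: mult_left_le_one_le)
  then have kn: "k < n" using assms by simp
  have x1: "?x \<ge> 1" "?y \<ge> 1"
    using L_coef_ge_1 assms by auto
  have y: "(?y - 1) * ?z = ?K"
    using L_coef_quadratic[OF assms(1,2), of n "Suc k"] by (simp add: algebra_simps)
  have "(real n - real k) * p < ?x * ?z"
  proof (rule L_coef_quadratics_step[where q = "1 - p" and K = ?K])
    show "?x\<^sup>2 + (p * real n - real k - 1) * ?x = (real n - real k) * p"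
      using L_coef_quadratic[OF assms(1,2), of n k] by (simp add: power2_eq_square algebra_simps)
    show "(real n - real k) * p = p * real n - real k + ?K - (1 - p)"
      by (simp add: algebra_simps)
    show "(?y - 1) * (?y + (p * real n - real k) - 1) = ?K"
      by (fact y)
  qed (use assms x1 in auto)
  moreover have b: "0 < binom_term n k p"
    using assms kn by (intro binom_term_pos) auto
  ultimately have "binom_term n k p * ((real n - real k) * p) < binom_term n k p * (?x * ?z)"
    by simp
  then have "binom_term n (Suc k) p * ((?y - 1) * ?z) < binom_term n k p * ?x * ?z"
    unfolding y binom_term_Suc[OF kn, symmetric] by (simp add: mult_ac)
  moreover have "?z > 0"
    using assms x1 by simp
  ultimately have "binom_term n (Suc k) p * (?y - 1) < binom_term n k p * ?x"
    by (simp add: mult.assoc[symmetric])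
  with IH show ?thesis
    by (simp add: binom_cdf_Suc algebra_simps)
qed

text \<open>Not strict, because equality holds at \<open>k = 0\<close>, where \<open>L = 1\<close>;
  each step is strict, which gives the strict bound for \<open>k \<ge> 1\<close>.\<close>

lemma L_coef_le_binom_cdf:
  assumes "0 < p" "p < 1" "real k \<le> p * real n"
  shows "L_coef n k p * binom_term n k p \<le> binom_cdf n k p"
  using assms(3)
proof (induction k)
  case 0
  then show ?case using assms by (simp add: binom_cdf_0 L_coef_def)
next
  case (Suc k)
  then show ?case using L_coef_less_binom_cdf_step[OF assms(1,2)] by (simp add: less_imp_le)
qed

lemma L_coef_less_binom_cdf:
  assumes "0 < p" "p < 1" "real k \<le> p * real n" "k \<ge> 1"
  shows "L_coef n k p * binom_term n k p < binom_cdf n k p"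
  using assms L_coef_less_binom_cdf_step[OF assms(1,2), of "k - 1" n] L_coef_le_binom_cdf[OF assms(1,2), of "k - 1" n]
  by (cases k) auto

section \<open>The upper bound with coefficients \<open>V\<close>\<close>

lemma V_coef_Suc: "V_coef n (Suc k) p (Suc a) = 1 + V_coef n k p a"
  by (simp add: V_coef_def algebra_simps)

lemma V_coef_pos:
  assumes "0 < p" "p < 1" "real k \<le> p * real n"
  shows "0 < V_coef n k p a"
proof -
  have "p * real n \<le> real n"
    using assms by (simp add: mult_left_le_one_le)
  then have "0 < p * (real n - real k + real a + 1) / (p * real n + p - real k + real a)"
    using assms by (intro divide_pos_pos mult_pos_pos) auto
  then show ?thesis
    unfolding V_coef_def by (intro add_nonneg_pos) auto
qed

text \<open>The hypothesis covers all \<open>a\<close> because a positive \<open>a\<close> is traced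
  back to \<open>a - 1\<close>. For \<open>a = 0\<close> there is no predecessor, and the values of
  \<open>V\<close> at 0 for \<open>k\<close> and \<open>k + 1\<close> are compared directly.\<close>

lemma binom_cdf_less_V_coef_step:
  assumes "0 < p" "p < 1" "real (Suc k) \<le> p * real n"
    and IH: "\<And>a. binom_cdf n k p \<le> V_coef n k p a * binom_term n k p"
  shows "binom_cdf n (Suc k) p < V_coef n (Suc k) p a * binom_term n (Suc k) p"
proof -
  let ?b = "binom_term n k p" and ?b' = "binom_term n (Suc k) p" and ?N = "real n - real k"
  have pn: "p * real n < real n"
    using assms by (cases "n = 0") auto
  then have kn: "k < n" using assms by simp
  have b: "0 < ?b" "0 < ?b'"
    using assms kn by (auto intro!: binom_term_pos)
  note Suc = binom_term_Suc[OF kn, of p]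
  show ?thesis
  proof (cases a)
    case 0
    \<comment> \<open>The denominator of \<open>V(n,k+1,p,0)\<close>, that of
      \<open>V(n,k,p,0)\<close> being \<open>e + 1\<close>. Passing from \<open>N/e\<close> to
      \<open>(N+1)/(e+1)\<close> decreases the fraction since \<open>e < N\<close>.\<close>
    let ?e = "p * real n + p - real (Suc k)"
    have e: "?e > 0" using assms by simp
    have "V_coef n k p 0 * ?b = p * (?N + 1) / (?e + 1) * ?b"
      by (simp add: V_coef_def algebra_simps)
    also have "\<dots> < p * ?N / ?e * ?b"
    proof -
      have "p * (real n + 1) < 1 * (real n + 1)"
        using assms by (intro mult_strict_right_mono) auto
      then have "?e < ?N" by (simp add: algebra_simps)
      then have "p * (?N + 1) / (?e + 1) < p * ?N / ?e"
        using e assms by (simp add: divide_simps) (simp add: algebra_simps)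
      then show ?thesis using b by (intro mult_strict_right_mono)
    qed
    also have "\<dots> = (?b * (?N * p)) / ?e"
      by simp
    also have "\<dots> = (V_coef n (Suc k) p 0 - 1) * ?b'"
      unfolding Suc[symmetric] V_coef_def using e by (simp add: field_simps)
    finally show ?thesis
      using IH[of 0] unfolding 0 by (simp add: binom_cdf_Suc algebra_simps)
  next
    case (Suc a')
    \<comment> \<open>Equivalent to \<open>k + 1 < pn + p\<close>: the terms still increase
      here.\<close>
    have "(real k + 1) * (1 - p) < ?N * p"
      using assms by (simp add: algebra_simps)
    then have "?b * ((real k + 1) * (1 - p)) < ?b * (?N * p)"
      using b by simp
    then have "?b * ((real k + 1) * (1 - p)) < ?b' * ((real k + 1) * (1 - p))"
      using binom_term_Suc[OF kn, of p] by simp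
    then have "?b < ?b'"
      by (rule mult_right_less_imp_less) (use assms in simp)
    then have "V_coef n k p a' * ?b < V_coef n k p a' * ?b'"
      using V_coef_pos[of p k n a'] assms by simp
    with IH[of a'] show ?thesis
      unfolding Suc by (simp add: binom_cdf_Suc V_coef_Suc algebra_simps)
  qed
qed

lemma binom_cdf_le_V_coef:
  assumes "0 < p" "p < 1" "real k \<le> p * real n"
  shows "binom_cdf n k p \<le> V_coef n k p a * binom_term n k p"
  using assms(3)
proof (induction k arbitrary: a)
  case 0
  have "1 \<le> V_coef n 0 p a"
  proof (cases a)
    case 0
    have "p * (real n + 1) = p * real n + p" "p * real n + p > 0"
      using assms by (auto simp: algebra_simps intro!: add_nonneg_pos)
    then show ?thesis using 0 by (simp add: V_coef_def)
  next
    case (Suc a')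
    then show ?thesis using V_coef_ge[OF assms(1,2), of 0 n a] assms(1) by simp
  qed
  then show ?case
    using binom_term_pos[OF assms(1,2), of 0 n] by (simp add: binom_cdf_0)
next
  case (Suc k)
  then show ?case using binom_cdf_less_V_coef_step[OF assms(1,2)] by (simp add: less_imp_le)
qed

lemma binom_cdf_less_V_coef:
  assumes "0 < p" "p < 1" "real k \<le> p * real n" "k \<ge> 1"
  shows "binom_cdf n k p < V_coef n k p a * binom_term n k p"
  using assms binom_cdf_less_V_coef_step[OF assms(1,2), of "k - 1" n] binom_cdf_le_V_coef[OF assms(1,2), of "k - 1" n]
  by (cases k) auto

section \<open>Comparison of \<open>U\<close> with \<open>L\<close> and of the two Robbins
  factors\<close>

lemma U_coef_le:
  assumes "0 < p" "p < 1" "real k \<le> p * real n"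
  shows "U_coef n k p \<le> V_coef n k p a"
  using U_coef_is_min[OF assms] by metis

lemma U_coef_less_twice_L_coef:
  assumes "0 < p" "p < 1" "real k \<le> p * real n"
  shows "U_coef n k p < 2 * L_coef n k p"
proof -
  let ?L = "L_coef n k p"
  define e where "e = p * real n + p - real k"
  define a where "a = nat \<lfloor>?L\<rfloor>"
  define t where "t = e + real a"
  have e: "e > 0" using assms by (simp add: e_def)
  have L: "?L \<ge> 1" using L_coef_ge_1 assms by simp
  then have a: "real a \<le> ?L" "?L - 1 \<le> real a"
    unfolding a_def by linarith+
  have t: "t > 0" using e by (simp add: t_def)
  have V: "V_coef n k p a = t - e + p * (real n - real k + real a + 1) / t"
    by (simp add: V_coef_def t_def e_def algebra_simps)
  \<comment> \<open>\<open>V(a) < 2L\<close> is quadratic in \<open>t\<close>; by the equation for \<open>L\<close> it factors up to the term \<open>t\<close>.\<close>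
  have "(t - (?L + e - 1)) * (t - (?L - p)) < t"
  \<comment> \<open>The first factor is \<open>a - L + 1\<close>, between 0 and 1; the second is
    below \<open>t\<close> because \<open>L \<ge> 1 > p\<close>. Only the sign of the second has to
    be distinguished.\<close>
  proof (cases "t - (?L - p) \<ge> 0")
    case True
    have "(t - (?L + e - 1)) * (t - (?L - p)) \<le> 1 * (t - (?L - p))"
      using True a by (intro mult_right_mono) (auto simp: t_def)
    also have "\<dots> < t" using L assms by simp
    finally show ?thesis .
  next
    case False
    have "(t - (?L + e - 1)) * (t - (?L - p)) \<le> 0"
      using False a by (intro mult_nonneg_nonpos) (auto simp: t_def)
    with t show ?thesis by simp
  qed
  moreover have "(t - (?L + e - 1)) * (t - (?L - p)) - t
      = (t - e) * t + p * (real n - real k + real a + 1) - 2 * ?L * t"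
    using L_coef_quadratic[OF assms(1,2), of n k] unfolding t_def e_def by algebra
  ultimately have "(t - e) * t + p * (real n - real k + real a + 1) < 2 * ?L * t"
    by linarith
  then have "V_coef n k p a < 2 * ?L"
    using t unfolding V by (simp add: field_simps)
  with U_coef_le[OF assms, of a] show ?thesis by simp
qed

text \<open>The exponent is the gap between the upper and lower Robbins exponents for
  \<open>x + y\<close>. The cases in the assumption exhaust all pairs of positive integers.\<close>

lemma exp_robbins_gap_le:
  fixes x y :: real
  assumes "x = 1 \<and> y = 1 \<or> x \<ge> 1 \<and> y \<ge> 2 \<or> x \<ge> 2 \<and> y \<ge> 1"
  shows "exp (1 / (12 * x) - 1 / (12 * x + 1) + (1 / (12 * y) - 1 / (12 * y + 1))
    - (1 / (12 * (x + y)) - 1 / (12 * (x + y) + 1))) \<le> 89 / 88" (is "exp ?d \<le> _")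
proof -
  define h :: "real \<Rightarrow> real" where "h t = 1 / (12 * t) - 1 / (12 * t + 1)" for t
  have h: "h t = 1 / (12 * t * (12 * t + 1))" if "t \<ge> 1" for t
    using that by (simp add: h_def field_simps)
  have h_nonneg: "0 \<le> h t" if "t \<ge> 1" for t
    using that by (simp add: h)
  have h_mono: "h t \<le> h s" if "1 \<le> s" "s \<le> t" for s t
    using that by (simp add: h frac_le mult_mono)
  have d: "?d = h x + h y - h (x + y)"
    by (simp add: h_def)
  have small: "h 1 + h 2 \<le> 1 / 89"
    by (simp add: h_def)
  have "?d \<le> 1 / 89"
    using assms
  proof (elim disjE conjE)
    \<comment> \<open>The tight case: \<open>2 h(1) - h(2) = 29/2600\<close> is just below
      \<open>1/89\<close>, whereas \<open>2 h(1) = 1/78\<close> is not.\<close>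
    assume "x = 1" "y = 1"
    then show ?thesis by simp
  next
    assume "x \<ge> 1" "y \<ge> 2"
    then have "h x \<le> h 1" "h y \<le> h 2" "0 \<le> h (x + y)"
      by (auto intro!: h_mono h_nonneg)
    with small show ?thesis unfolding d by linarith
  next
    assume "x \<ge> 2" "y \<ge> 1"
    then have "h x \<le> h 2" "h y \<le> h 1" "0 \<le> h (x + y)"
      by (auto intro!: h_mono h_nonneg)
    with small show ?thesis unfolding d by linarith
  qed
  moreover have "exp t \<le> 89 / 88" if "t \<le> 1 / 89" for t :: real
  proof -
    \<comment> \<open>Uses \<open>88/89 \<le> 1 - t \<le> exp (-t)\<close>.\<close>
    have "exp t * (88 / 89) \<le> exp t * exp (- t)"
      using that exp_ge_add_one_self[of "- t"] by (intro mult_left_mono) auto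
    then show ?thesis
      by (simp only: exp_minus_inverse)
  qed
  ultimately show ?thesis by blast
qed

section \<open>Assembly of the bounds on the sum, the term and the coefficients\<close>

theorem theorem2p2:
  fixes n k :: nat and p f :: real
  assumes "n \<ge> 1" and "k \<ge> 1" and "0 < p" and "p < 1" and "real k \<le> p * real n"
    and "f = real k / real n"
  shows "(sqrt (real n) * L_coef n k p / sqrt (8 * real k * (real n - real k))
            * exp (- real n * rel_entropy (real k / real n) p) < binom_cdf n k p
          \<and> binom_cdf n k p
            < sqrt (real n) * U_coef n k p / sqrt (2 * pi * real k * (real n - real k))
              * exp (- real n * rel_entropy (real k / real n) p))
       \<and> (B_down n k p < binom_cdf n k p
          \<and> binom_cdf n k p < B_up n k p
          \<and> B_up n k p < 89 / 44 * B_down n k p)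
       \<and> (real k < p * real n \<longrightarrow>
            binom_cdf n k p < B_up n k p
            \<and> B_up n k p < sqrt (1 - f) * p / (sqrt (2 * pi * f) * (p - f))
                * exp (- real n * rel_entropy f p))"
proof -
  let ?L = "L_coef n k p" and ?U = "U_coef n k p" and ?B = "binom_cdf n k p" and ?b = "binom_term n k p"
  define m where "m = n - k"
  have "p * real n < real n" using assms by simp
  with assms(5) have "real k < real n" by (rule le_less_trans)
  then have kn: "k < n" by simp
  then have m: "m \<ge> 1" and n: "n = k + m" and rm: "real n - real k = real m"
    by (auto simp: m_def)
  have pos: "real k > 0" "real m > 0" "real n > 0"
    using assms m by auto
  define E where "E = stirling_error n - stirling_error k - stirling_error m"
  define lo where "lo = 1 / (12 * real n) - 1 / (12 * real k) - 1 / (12 * real m)"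
  define hi where "hi = 1 / (12 * real n + 1) - 1 / (12 * real k + 1) - 1 / (12 * real m + 1)"
  define S where "S = sqrt (real n) / sqrt (2 * pi * real k * real m)"
  define X where "X = exp (- real n * rel_entropy (real k / real n) p)"
  have SX: "S > 0" "X > 0" using pos by (auto simp: S_def X_def)
  have b: "?b = S * X * exp E"
    using binom_term_stirling[OF assms(2) m assms(3,4)] by (simp add: n S_def X_def E_def)
  have E: "lo < E" "E < hi"
    using stirling_error_add_lower[OF assms(2) m] stirling_error_add_upper[OF assms(2) m]
    unfolding lo_def hi_def E_def n by auto
  \<comment> \<open>Allows the Robbins factor to be dropped in the upper bounds \<open>part2\<close>
    and \<open>part6\<close>.\<close>
  have hi0: "hi < 0"
  proof -
    have "1 / (12 * real n + 1) < 1 / (12 * real k + 1)"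
      using kn by (intro divide_strict_left_mono) auto
    moreover have "0 < 1 / (12 * real m + 1)" by simp
    ultimately show ?thesis unfolding hi_def by linarith
  qed
  have L: "?L \<ge> 1" using L_coef_ge_1 assms by simp
  have LB: "?L * ?b < ?B" using L_coef_less_binom_cdf assms by simp
  obtain a where a: "?U = V_coef n k p a"
    using U_coef_is_min assms by blast
  have U: "?U > 0" using V_coef_pos assms a by simp
  have BU: "?B < ?U * ?b" unfolding a using binom_cdf_less_V_coef assms by simp
  have down: "B_down n k p = ?L * (S * X * exp lo)"
    by (simp add: B_down_def rm S_def X_def lo_def)
  have up: "B_up n k p = ?U * (S * X * exp hi)"
    by (simp add: B_up_def rm S_def X_def hi_def)

  have part1: "sqrt (real n) * ?L / sqrt (8 * real k * (real n - real k)) * X < ?B"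
  proof -
    \<comment> \<open>The factor \<open>sqrt (pi/4)\<close> turns \<open>2 pi\<close> under the root
      into 8. Equality can occur here, so strictness comes from \<open>LB\<close>.\<close>
    have "sqrt (pi / 4) \<le> sqrt (exp (2 * E))"
      using pi_div_4_le_exp_stirling_error[OF assms(2) m] unfolding E_def n by simp
    also have "\<dots> = exp E"
      by (simp add: exp_double)
    finally have "S * X * sqrt (pi / 4) \<le> ?b"
      unfolding b using SX by simp
    moreover have "S * sqrt (pi / 4) = sqrt (real n) / sqrt (8 * real k * real m)"
    proof -
      have "real n / (2 * pi * real k * real m) * (pi / 4) = real n / (8 * real k * real m)"
        using pos by simp
      then show ?thesis
        unfolding S_def by (metis real_sqrt_divide real_sqrt_mult)
    qed
    ultimately have "sqrt (real n) / sqrt (8 * real k * real m) * X \<le> ?b"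
      by (metis mult.assoc mult.commute)
    then have "?L * (sqrt (real n) / sqrt (8 * real k * real m) * X) \<le> ?L * ?b"
      by (rule mult_left_mono) (use L in simp)
    with LB show ?thesis unfolding rm by (simp add: mult_ac)
  qed
  have part2: "?B < sqrt (real n) * ?U / sqrt (2 * pi * real k * (real n - real k)) * X"
  proof -
    have "?b < S * X * 1"
      unfolding b using SX E hi0 by (intro mult_strict_left_mono) auto
    then have "?U * ?b < ?U * (S * X)" using U by simp
    with BU have "?B < ?U * (S * X)" by simp
    then show ?thesis by (simp add: S_def rm mult_ac)
  qed
  have part3: "B_down n k p < ?B"
  proof -
    have "S * X * exp lo < ?b" unfolding b using SX E by simp
    then have "?L * (S * X * exp lo) < ?L * ?b" using L by simp
    with LB show ?thesis by (simp add: down)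
  qed
  have part4: "?B < B_up n k p"
  proof -
    have "?b < S * X * exp hi" unfolding b using SX E by simp
    then have "?U * ?b < ?U * (S * X * exp hi)" using U by simp
    with BU show ?thesis by (simp add: up)
  qed
  have part5: "B_up n k p < 89 / 44 * B_down n k p"
  proof -
    have "k = 1 \<and> m = 1 \<or> k \<ge> 1 \<and> m \<ge> 2 \<or> k \<ge> 2 \<and> m \<ge> 1"
      using assms(2) m by linarith
    then have "exp (hi - lo) \<le> 89 / 88"
      using exp_robbins_gap_le[of "real k" "real m"] unfolding hi_def lo_def n
      by (auto simp: algebra_simps)
    then have "exp hi \<le> 89 / 88 * exp lo"
      by (simp add: exp_diff field_simps)
    then have "B_up n k p \<le> ?U * (S * X * (89 / 88 * exp lo))"
      unfolding up using U SX by (intro mult_left_mono) auto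
    also have "\<dots> < 2 * ?L * (S * X * (89 / 88 * exp lo))"
      using U_coef_less_twice_L_coef[OF assms(3-5)] SX by (intro mult_strict_right_mono) auto
    also have "\<dots> = 89 / 44 * B_down n k p"
      unfolding down by simp
    finally show ?thesis .
  qed
  have part6: "B_up n k p < sqrt (1 - f) * p / (sqrt (2 * pi * f) * (p - f))
      * exp (- real n * rel_entropy f p)" if less: "real k < p * real n"
  proof -
    define T where "T = sqrt (1 - f) * p / (sqrt (2 * pi * f) * (p - f))"
    \<comment> \<open>\<open>V\<close> at \<open>a = 0\<close>. Removing \<open>p\<close> from
      numerator and denominator increases the fraction, since \<open>p m\<close> exceeds
      \<open>pn - k\<close>.\<close>
    let ?V = "p * (real m + 1) / (p * real n - real k + p)"
    have "?U \<le> ?V"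
      using U_coef_le[OF assms(3-5), of 0] unfolding V_coef_def rm[symmetric] by (simp add: algebra_simps)
    also have "?V < p * real m / (p * real n - real k)"
    proof -
      have "p * real n - real k < real m * p"
        using assms(3,4) pos unfolding n by (simp add: algebra_simps)
      then show ?thesis
        using less assms(3,4) by (simp add: divide_simps) (simp add: algebra_simps)
    qed
    finally have U: "?U < p * real m / (p * real n - real k)" .
    have "B_up n k p \<le> ?U * (S * X)"
      unfolding up using U SX \<open>?U > 0\<close> hi0 by simp
    also have "\<dots> < p * real m / (p * real n - real k) * (S * X)"
      using U SX by (intro mult_strict_right_mono) auto
    also have "\<dots> = T / sqrt (real n) * X"
    proof -
      define u v w d where "u = sqrt (real m)" "v = sqrt (real n)" "w = sqrt (2 * pi * real k)"
        "d = p * real n - real k"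
      note defs = this
      have uvwd: "u > 0" "v > 0" "w > 0" "d > 0"
        using pos less by (simp_all add: defs)
      have sq: "real m = u * u" "real n = v * v"
        using pos by (simp_all add: defs)
      have "1 - f = real m / real n"
        using pos unfolding assms(6) n by (simp add: field_simps)
      then have "sqrt (1 - f) = u / v"
        by (simp add: real_sqrt_divide defs)
      moreover have "sqrt (2 * pi * f) = w / v"
        unfolding assms(6) by (simp add: real_sqrt_divide defs)
      moreover have "p - f = d / (v * v)"
        using pos unfolding assms(6) sq(2)[symmetric] by (simp add: defs field_simps)
      ultimately have T: "T = u / v * p / (w / v * (d / (v * v)))"
        by (simp add: T_def)
      have S: "S = v / (w * u)"
        unfolding S_def by (simp add: defs real_sqrt_mult)
      show ?thesis
        unfolding T S sq(1) defs(3)[symmetric] defs(4)[symmetric] defs(2)[symmetric]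
        using uvwd by (simp add: field_simps)
    qed
    \<comment> \<open>The argument gains an extra factor \<open>1 / sqrt n\<close>, which is at most
      1.\<close>
    also have "\<dots> \<le> T * X"
    proof -
      have "f < p"
        using less pos unfolding assms(6) by (simp add: field_simps)
      moreover have "0 \<le> f" "f \<le> 1"
        using pos unfolding assms(6) n by auto
      ultimately have "T \<ge> 0"
        using assms(3) by (simp add: T_def)
      then have "T / sqrt (real n) \<le> T"
        using assms(1) divide_left_mono[of 1 "sqrt (real n)" T] by simp
      then show ?thesis
        by (rule mult_right_mono) (use SX in simp)
    qed
    finally show ?thesis by (simp add: X_def T_def assms(6))
  qed
  from part1 part2 part3 part4 part5 part6 show ?thesis
    by (simp add: X_def)
qed

end
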